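(* Let $d\ge2$, $f\ge2$, and let $M=\{M_i\}_{i=1}^f$ be a collection of real mutually unbiased bases of $\mathbb{R}^d$. Let $X=\bigcup_{i=1}^f\big(M_i\cup(-M_i)\big)\subset S^{d-1}$, let $\alpha_0=1$, $\alpha_1=\frac1{\sqrt d}$, $\alpha_2=0$, $\alpha_3=-\frac1{\sqrt d}$, $\alpha_4=-1$, and let $R_k=\{(x,y)\in X\times X\mid\langle x,y\rangle=\alpha_k\}$ for $0\le k\le4$. Then $(X,\{R_k\}_{k=0}^4)$ is a triply regular association scheme.
   Context: Real mutually unbiased bases (MUB): a collection $M=\{M_i\}_{i=1}^f$ of orthonormal bases of $\mathbb{R}^d$ such that any two vectors $x,y$ from different bases satisfy $\langle x,y\rangle=\pm1/\sqrt d$. Symmetric association scheme: a finite set $X$ with a partition $\{R_k\}_{k=0}^s$ of $X\times X$ into symmetric relations, $R_0$ being the diagonal, such that for all $i,j,k$ the number $|\{w\in X\mid(x,w)\in R_i,(w,y)\in R_j\}|$ is independent of the choice of $(x,y)\in R_k$. A symmetric association scheme is triply regular if for all $i,j,k,l,m,n\in\{0,\dots,s\}$ and all $x,y,z\in X$ with $(x,y)\in R_i$, $(y,z)\in R_j$, $(z,x)\in R_k$, the number $|\{w\in X\mid(w,x)\in R_m,(w,y)\in R_n,(w,z)\in R_l\}|$ depends only on $i,j,k,l,m,n$ and not on $x,y,z$. *)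

theory Defs
  imports "HOL-Analysis.Analysis" "HOL-Library.Disjoint_Sets"
begin

definition orthonormal_basis :: "('a::euclidean_space) set \<Rightarrow> bool" where
  "orthonormal_basis B \<longleftrightarrow>
     pairwise orthogonal B \<and> (\<forall>x\<in>B. norm x = 1) \<and> independent B \<and> span B = UNIV"

definition real_MUB :: "nat \<Rightarrow> (nat \<Rightarrow> (real ^ 'n) set) \<Rightarrow> bool" where
  "real_MUB f M \<longleftrightarrow>
     (\<forall>i\<in>{1..f}. orthonormal_basis (M i)) \<and>
     (\<forall>i\<in>{1..f}. \<forall>j\<in>{1..f}. i \<noteq> j \<longrightarrow>
        (\<forall>x\<in>M i. \<forall>y\<in>M j. x \<bullet> y = 1 / sqrt (CARD('n)) \<or> x \<bullet> y = - 1 / sqrt (CARD('n))))"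

definition MUB_points :: "nat \<Rightarrow> (nat \<Rightarrow> (real ^ 'n) set) \<Rightarrow> (real ^ 'n) set" where
  "MUB_points f M = (\<Union>i\<in>{1..f}. M i \<union> uminus ` M i)"

definition MUB_alpha :: "nat \<Rightarrow> nat \<Rightarrow> real" where
  "MUB_alpha d k = [1, 1 / sqrt d, 0, - 1 / sqrt d, - 1] ! k"

definition MUB_rel :: "nat \<Rightarrow> (nat \<Rightarrow> (real ^ 'n) set) \<Rightarrow> nat \<Rightarrow> ((real ^ 'n) \<times> (real ^ 'n)) set" where
  "MUB_rel f M k =
     {(x, y) \<in> MUB_points f M \<times> MUB_points f M. x \<bullet> y = MUB_alpha CARD('n) k}"

(* partition_on speaks about the set of classes only (and makes every class nonempty);
   inj_on makes R 0, ..., R s pairwise different, hence pairwise disjoint. *)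
definition symmetric_association_scheme :: "'a set \<Rightarrow> nat \<Rightarrow> (nat \<Rightarrow> ('a \<times> 'a) set) \<Rightarrow> bool" where
  "symmetric_association_scheme X s R \<longleftrightarrow>
     finite X \<and>
     partition_on (X \<times> X) (R ` {0..s}) \<and> inj_on R {0..s} \<and>
     (\<forall>k\<in>{0..s}. sym (R k)) \<and>
     R 0 = Id_on X \<and>
     (\<forall>i\<in>{0..s}. \<forall>j\<in>{0..s}. \<forall>k\<in>{0..s}. \<exists>p. \<forall>x y. (x, y) \<in> R k \<longrightarrow>
        card {w \<in> X. (x, w) \<in> R i \<and> (w, y) \<in> R j} = p)"

definition triply_regular_scheme :: "'a set \<Rightarrow> nat \<Rightarrow> (nat \<Rightarrow> ('a \<times> 'a) set) \<Rightarrow> bool" where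
  "triply_regular_scheme X s R \<longleftrightarrow>
     symmetric_association_scheme X s R \<and>
     (\<forall>i\<in>{0..s}. \<forall>j\<in>{0..s}. \<forall>k\<in>{0..s}. \<forall>l\<in>{0..s}. \<forall>m\<in>{0..s}. \<forall>n\<in>{0..s}.
        \<exists>p. \<forall>x\<in>X. \<forall>y\<in>X. \<forall>z\<in>X. (x, y) \<in> R i \<and> (y, z) \<in> R j \<and> (z, x) \<in> R k \<longrightarrow>
          card {w \<in> X. (w, x) \<in> R m \<and> (w, y) \<in> R n \<and> (w, z) \<in> R l} = p)"

end

theory Submission imports Defs
begin

text \<open>
  An intersection number of a triple \<open>x, y, z\<close> of points is a sum
  \<open>\<Sum>w\<in>X. \<phi> (w \<bullet> x) * \<psi> (w \<bullet> y) * \<rho> (w \<bullet> z)\<close>, where \<open>\<phi>\<close>, \<open>\<psi>\<close>, \<open>\<rho>\<close> are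
  indicators of single values. We show, for arbitrary real functions \<open>\<phi>\<close>, \<open>\<psi>\<close>, \<open>\<rho>\<close>, that
  such a sum is a function of \<open>x \<bullet> y\<close>, \<open>y \<bullet> z\<close> and \<open>z \<bullet> x\<close> only
  (\<open>gram_determined_triple_sum\<close>).

  Put \<open>s = 1 / sqrt d\<close>, and call \<open>M i \<union> - M i\<close> a block. Two points lie in the same block
  exactly when their inner product is \<open>0\<close>, \<open>1\<close> or \<open>- 1\<close>. So on the three values
  \<open>s, 0, - s\<close> every function \<open>\<phi>\<close> agrees with one of the form
  \<open>t \<mapsto> k + g * [t \<in> {0, 1, - 1}] + l * t\<close>, which, as a function of \<open>w\<close> with \<open>t = w \<bullet> x\<close>,
  is affine on each block. The error is supported on \<open>t = 1\<close> and \<open>t = - 1\<close>, that is, on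
  \<open>w = x\<close> and \<open>w = - x\<close>. By multilinearity, two kinds of sums remain.

  If one factor is such an error term, the sum has only the two terms \<open>w = x\<close> and \<open>w = - x\<close>,
  and its value is visible from the inner products (\<open>sum_supported_at_antipodes\<close>).

  If all three factors are affine on blocks, then in each block the parts of odd degree cancel
  between \<open>w\<close> and \<open>- w\<close>, and Parseval's identity evaluates the parts of degree two
  (\<open>sum_antipodal_affine3\<close>). What depends on the block is only which of \<open>x, y, z\<close> it contains;
  summing over the blocks therefore gives terms that record which of \<open>x, y, z\<close> share a
  block, and the inner products tell this (\<open>gram_determined_block_affine\<close>).

  The intersection numbers of pairs are those of the degenerate triples \<open>x, y, y\<close>.
\<close>

section \<open>Moments of an antipodal orthonormal basis\<close>

lemma orthonormal_basis_inner:
  fixes B :: "('a::euclidean_space) set"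
  assumes "orthonormal_basis B" "x \<in> B" "y \<in> B"
  shows "x \<bullet> y = of_bool (x = y)"
  using assms by (auto simp: orthonormal_basis_def pairwise_def orthogonal_def norm_eq_1)

lemma orthonormal_basis_finite:
  fixes B :: "('a::euclidean_space) set"
  assumes "orthonormal_basis B"
  shows "finite B"
  using assms by (auto simp: orthonormal_basis_def intro: independent_imp_finite)

lemma orthonormal_basis_card:
  fixes B :: "('a::euclidean_space) set"
  assumes "orthonormal_basis B"
  shows "card B = DIM('a)"
  using assms dim_eq_card_independent[of B] dim_span[of B]
  by (simp add: orthonormal_basis_def)

lemma parseval:
  fixes B :: "('a::euclidean_space) set"
  assumes "orthonormal_basis B"
  shows "(\<Sum>w\<in>B. (w \<bullet> x) * (w \<bullet> y)) = x \<bullet> y"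
proof -
  have "(\<Sum>w\<in>B. (x \<bullet> w) *\<^sub>R w) = x"
    using assms orthonormal_basis_finite[OF assms]
    by (intro orthonormal_basis_expand) (auto simp: orthonormal_basis_def)
  then have "x \<bullet> y = (\<Sum>w\<in>B. (x \<bullet> w) *\<^sub>R w) \<bullet> y" by simp
  also have "\<dots> = (\<Sum>w\<in>B. (w \<bullet> x) * (w \<bullet> y))"
    by (simp add: inner_sum_left inner_commute[of x])
  finally show ?thesis ..
qed

definition antipodal :: "('a::euclidean_space) set \<Rightarrow> 'a set" where
  "antipodal B = B \<union> uminus ` B"

lemma antipodal_uminus: "x \<in> antipodal B \<Longrightarrow> - x \<in> antipodal B"
  by (auto simp: antipodal_def)

lemma finite_antipodal:
  "orthonormal_basis B \<Longrightarrow> finite (antipodal B)"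
  by (simp add: antipodal_def orthonormal_basis_finite)

lemma inner_antipodal:
  assumes "orthonormal_basis B" "x \<in> antipodal B" "y \<in> antipodal B"
  shows "x \<bullet> y \<in> {0, 1, - 1}"
  using assms by (auto simp: antipodal_def orthonormal_basis_inner)

lemma norm_antipodal:
  assumes "orthonormal_basis B" "x \<in> antipodal B"
  shows "norm x = 1"
  using assms by (auto simp: antipodal_def orthonormal_basis_def)

lemma sum_antipodal:
  fixes g :: "'a::euclidean_space \<Rightarrow> real"
  assumes "orthonormal_basis B"
  shows "sum g (antipodal B) = (\<Sum>w\<in>B. g w + g (- w))"
proof -
  have "B \<inter> uminus ` B = {}"
  proof (rule ccontr)
    assume "B \<inter> uminus ` B \<noteq> {}"
    then obtain u v where uv: "u \<in> B" "v \<in> B" "u = - v" by auto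
    then have "u \<bullet> v = - 1"
      using orthonormal_basis_inner[OF assms \<open>v \<in> B\<close> \<open>v \<in> B\<close>] by simp
    moreover have "u \<bullet> v \<ge> 0" using orthonormal_basis_inner[OF assms uv(1,2)] by simp
    ultimately show False by simp
  qed
  then have "sum g (antipodal B) = sum g B + sum g (uminus ` B)"
    using orthonormal_basis_finite[OF assms] by (simp add: antipodal_def sum.union_disjoint)
  also have "sum g (uminus ` B) = (\<Sum>w\<in>B. g (- w))"
    by (simp add: sum.reindex)
  finally show ?thesis by (simp add: sum.distrib)
qed

text \<open>
  The antipodal basis has the moments of a spherical \<open>3\<close>-design: odd monomials in \<open>w\<close> sum to
  zero by \<open>w \<mapsto> - w\<close>, and quadratic ones are given by Parseval's identity. Of the expanded
  product, only the constant and the three mixed quadratic terms survive.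
\<close>

lemma sum_antipodal_affine3:
  fixes B :: "('a::euclidean_space) set" and a b c a' b' c' :: real
  assumes "orthonormal_basis B"
  shows "(\<Sum>w\<in>antipodal B. (a + a' * (w \<bullet> x)) * (b + b' * (w \<bullet> y)) * (c + c' * (w \<bullet> z)))
    = 2 * (DIM('a) * (a * b * c) + a * (b' * c' * (y \<bullet> z)) + b * (a' * c' * (x \<bullet> z))
         + c * (a' * b' * (x \<bullet> y)))"
proof -
  have "(\<Sum>w\<in>antipodal B. (a + a' * (w \<bullet> x)) * (b + b' * (w \<bullet> y)) * (c + c' * (w \<bullet> z)))
    = (\<Sum>w\<in>B. 2 * (a * b * c) + 2 * a * b' * c' * ((w \<bullet> y) * (w \<bullet> z))
        + 2 * b * a' * c' * ((w \<bullet> x) * (w \<bullet> z)) + 2 * c * a' * b' * ((w \<bullet> x) * (w \<bullet> y)))"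
    unfolding sum_antipodal[OF assms] by (intro sum.cong) (simp_all add: algebra_simps)
  also have "\<dots> = card B * (2 * (a * b * c)) + 2 * a * b' * c' * (y \<bullet> z)
        + 2 * b * a' * c' * (x \<bullet> z) + 2 * c * a' * b' * (x \<bullet> y)"
    by (simp add: sum.distrib parseval[OF assms] flip: sum_distrib_left)
  finally show ?thesis
    by (simp add: orthonormal_basis_card[OF assms] algebra_simps)
qed

section \<open>Functions of a triple determined by its Gram matrix\<close>

definition gram_determined ::
  "('a::real_inner) set \<Rightarrow> ('a \<Rightarrow> 'a \<Rightarrow> 'a \<Rightarrow> real) \<Rightarrow> bool" where
  "gram_determined X G \<longleftrightarrow>
     (\<exists>H. \<forall>x\<in>X. \<forall>y\<in>X. \<forall>z\<in>X. G x y z = H (x \<bullet> y) (y \<bullet> z) (z \<bullet> x))"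

lemma gram_determinedI:
  assumes "\<And>x y z. x \<in> X \<Longrightarrow> y \<in> X \<Longrightarrow> z \<in> X \<Longrightarrow> G x y z = H (x \<bullet> y) (y \<bullet> z) (z \<bullet> x)"
  shows "gram_determined X G"
  using assms by (auto simp: gram_determined_def)

lemma gram_determined_add:
  assumes "gram_determined X F" "gram_determined X G"
  shows "gram_determined X (\<lambda>x y z. F x y z + G x y z)"
proof -
  obtain H K where
    "\<And>x y z. x \<in> X \<Longrightarrow> y \<in> X \<Longrightarrow> z \<in> X \<Longrightarrow> F x y z = H (x \<bullet> y) (y \<bullet> z) (z \<bullet> x)"
    "\<And>x y z. x \<in> X \<Longrightarrow> y \<in> X \<Longrightarrow> z \<in> X \<Longrightarrow> G x y z = K (x \<bullet> y) (y \<bullet> z) (z \<bullet> x)"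
    using assms unfolding gram_determined_def by metis
  then show ?thesis
    by (intro gram_determinedI[where H = "\<lambda>u v w. H u v w + K u v w"]) simp
qed

text \<open>
  The indices will be the blocks, with \<open>p, q, r\<close> those of the points \<open>x, y, z\<close>. The right-hand
  side refers to \<open>p, q, r\<close> only through the equalities between them, since a product of point
  masses is summed to \<open>0\<close> unless the masses sit at the same index.
\<close>

lemma sum_point_masses:
  fixes a b c a' b' c' :: real
  assumes "finite I" "p \<in> I" "q \<in> I" "r \<in> I"
  shows "(\<Sum>i\<in>I. (a + a' * of_bool (i = p)) * (b + b' * of_bool (i = q)) * (c + c' * of_bool (i = r)))
    = card I * (a * b * c) + a' * b * c + a * b' * c + a * b * c'
      + a' * b' * c * of_bool (p = q) + a * b' * c' * of_bool (q = r)
      + a' * b * c' * of_bool (r = p) + a' * b' * c' * (of_bool (p = q) * of_bool (q = r))"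
proof -
  have one: "(\<Sum>i\<in>I. of_bool (i = s) :: real) = 1" if "s \<in> I" for s
    using assms(1) that by (simp add: of_bool_def)
  have two: "(\<Sum>i\<in>I. of_bool (i = s) * of_bool (i = t) :: real) = of_bool (s = t)"
    if "s \<in> I" for s t
  proof -
    have "(\<Sum>i\<in>I. of_bool (i = s) * of_bool (i = t) :: real)
        = (\<Sum>i\<in>I. of_bool (i = s) * of_bool (s = t))"
      by (intro sum.cong) auto
    then show ?thesis using one[OF that] by (simp flip: sum_distrib_right)
  qed
  have three: "(\<Sum>i\<in>I. of_bool (i = p) * of_bool (i = q) * of_bool (i = r) :: real)
      = of_bool (p = q) * of_bool (q = r)"
  proof -
    have "(\<Sum>i\<in>I. of_bool (i = p) * of_bool (i = q) * of_bool (i = r) :: real)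
        = (\<Sum>i\<in>I. of_bool (i = p) * (of_bool (p = q) * of_bool (q = r)))"
      by (intro sum.cong) auto
    then show ?thesis using one[OF assms(2)] by (simp flip: sum_distrib_right)
  qed
  have "(\<Sum>i\<in>I. (a + a' * of_bool (i = p)) * (b + b' * of_bool (i = q)) * (c + c' * of_bool (i = r)))
    = (\<Sum>i\<in>I. a * b * c + a' * b * c * of_bool (i = p) + a * b' * c * of_bool (i = q)
        + a * b * c' * of_bool (i = r)
        + a' * b' * c * (of_bool (i = p) * of_bool (i = q))
        + a * b' * c' * (of_bool (i = q) * of_bool (i = r))
        + a' * b * c' * (of_bool (i = r) * of_bool (i = p))
        + a' * b' * c' * (of_bool (i = p) * of_bool (i = q) * of_bool (i = r)))"
    by (intro sum.cong) (simp_all only: algebra_simps)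
  also have "\<dots> = card I * (a * b * c) + a' * b * c + a * b' * c + a * b * c'
      + a' * b' * c * of_bool (p = q) + a * b' * c' * of_bool (q = r)
      + a' * b * c' * of_bool (r = p) + a' * b' * c' * (of_bool (p = q) * of_bool (q = r))"
    unfolding sum.distrib sum_distrib_left[symmetric] three two[OF assms(2)] two[OF assms(3)]
      two[OF assms(4)] one[OF assms(2)] one[OF assms(3)] one[OF assms(4)]
    by simp
  finally show ?thesis .
qed

section \<open>Triple sums over mutually unbiased bases\<close>

text \<open>
  At \<open>t = w \<bullet> x\<close> the indicator says that \<open>w\<close> and \<open>x\<close> lie in the same block, so that for \<open>w\<close>
  ranging over one block this is an affine function of \<open>w \<bullet> x\<close>.
\<close>

definition block_affine :: "real \<Rightarrow> real \<Rightarrow> real \<Rightarrow> real \<Rightarrow> real" where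
  "block_affine k g l t = (k + g * of_bool (t \<in> {0, 1, - 1})) + l * t"

text \<open>
  The common absolute value \<open>s\<close> of the inner products between different bases is a parameter,
  because a constant defined from the dimension \<open>CARD('n)\<close> alone would carry the type \<open>'n\<close>
  as an extra argument.
\<close>

locale real_mub_system =
  fixes M :: "nat \<Rightarrow> (real ^ 'n) set" and f :: nat and s :: real
  assumes dim_ge_2: "CARD('n) \<ge> 2" and mub: "real_MUB f M"
    and s_def: "s = 1 / sqrt CARD('n)"
begin

abbreviation "X \<equiv> MUB_points f M"

abbreviation "block i \<equiv> antipodal (M i)"

lemma s_bounds: "0 < s" "s < 1"
  using dim_ge_2 by (auto simp: s_def)

lemma basis: "i \<in> {1..f} \<Longrightarrow> orthonormal_basis (M i)"
  using mub by (simp add: real_MUB_def)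

lemma X_eq: "X = (\<Union>i\<in>{1..f}. block i)"
  by (simp add: MUB_points_def antipodal_def)

lemma X_uminus: "x \<in> X \<Longrightarrow> - x \<in> X"
  by (auto simp: X_eq intro: antipodal_uminus)

lemma finite_X: "finite X"
  by (auto simp: X_eq finite_antipodal[OF basis])

lemma X_norm: "x \<in> X \<Longrightarrow> norm x = 1"
  using norm_antipodal[OF basis] unfolding X_eq by blast

lemma X_inner_self: "x \<in> X \<Longrightarrow> x \<bullet> x = 1"
  using X_norm norm_eq_1 by blast

lemma inner_different_blocks:
  assumes "i \<in> {1..f}" "j \<in> {1..f}" "i \<noteq> j" "x \<in> block i" "y \<in> block j"
  shows "x \<bullet> y \<in> {s, - s}"
proof -
  have "u \<bullet> v = s \<or> u \<bullet> v = - s" if "u \<in> M i" "v \<in> M j" for u v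
    using mub assms(1-3) that unfolding real_MUB_def s_def minus_divide_left by blast
  then show ?thesis using assms(4,5) by (fastforce simp: antipodal_def)
qed

lemma inner_block_iff:
  assumes "i \<in> {1..f}" "j \<in> {1..f}" "x \<in> block i" "y \<in> block j"
  shows "x \<bullet> y \<in> {0, 1, - 1} \<longleftrightarrow> i = j"
  using inner_antipodal[OF basis[OF assms(1)] assms(3)] inner_different_blocks[OF assms(1,2)]
    assms s_bounds by fastforce

lemma inner_cases:
  assumes "x \<in> X" "y \<in> X"
  shows "x \<bullet> y \<in> {1, s, 0, - s, - 1}"
proof -
  obtain i j where ij: "i \<in> {1..f}" "j \<in> {1..f}" "x \<in> block i" "y \<in> block j"
    using assms by (auto simp: X_eq)
  show ?thesis
    using inner_block_iff[OF ij] inner_different_blocks[OF ij(1,2) _ ij(3,4)] by blast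
qed

lemma inner_eq_1_iff:
  assumes "x \<in> X" "y \<in> X"
  shows "x \<bullet> y = 1 \<longleftrightarrow> x = y"
proof -
  have "(x - y) \<bullet> (x - y) = 2 - 2 * (x \<bullet> y)"
    using X_inner_self assms by (simp add: inner_diff_left inner_diff_right inner_commute)
  then show ?thesis using inner_eq_zero_iff[of "x - y"] by auto
qed

lemma inner_eq_minus_1_iff: "x \<in> X \<Longrightarrow> y \<in> X \<Longrightarrow> x \<bullet> y = - 1 \<longleftrightarrow> x = - y"
  using inner_eq_1_iff[of x "- y"] X_uminus[of y] by auto

lemma sum_X: "sum g X = (\<Sum>i\<in>{1..f}. sum g (block i))"
  for g :: "real ^ 'n \<Rightarrow> real"
  unfolding X_eq
proof (rule sum.UNION_disjoint)
  show "\<forall>i\<in>{1..f}. \<forall>j\<in>{1..f}. i \<noteq> j \<longrightarrow> block i \<inter> block j = {}"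
  proof (intro ballI impI equals0I)
    fix i j x assume ij: "i \<in> {1..f}" "j \<in> {1..f}" "i \<noteq> j" and x: "x \<in> block i \<inter> block j"
    then have "x \<in> X" by (auto simp: X_eq)
    then show False using inner_block_iff[OF ij(1,2), of x x] ij x by (simp add: X_inner_self)
  qed
qed (simp_all add: finite_antipodal[OF basis])

lemma sum_supported_at_antipodes:
  fixes F :: "real ^ 'n \<Rightarrow> real"
  assumes x: "x \<in> X" and zero: "\<phi> s = 0" "\<phi> 0 = 0" "\<phi> (- s) = 0"
  shows "(\<Sum>w\<in>X. \<phi> (w \<bullet> x) * F w) = \<phi> 1 * F x + \<phi> (- 1) * F (- x)"
proof -
  have "(\<Sum>w\<in>X. \<phi> (w \<bullet> x) * F w) = (\<Sum>w\<in>{x, - x}. \<phi> (w \<bullet> x) * F w)"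
  proof (rule sum.mono_neutral_right[OF finite_X])
    show "{x, - x} \<subseteq> X" using x X_uminus by auto
    show "\<forall>w\<in>X - {x, - x}. \<phi> (w \<bullet> x) * F w = 0"
    proof
      fix w assume w: "w \<in> X - {x, - x}"
      then have "w \<bullet> x \<in> {s, 0, - s}"
        using inner_cases[of w x] inner_eq_1_iff[of w x] inner_eq_minus_1_iff[of w x] x by auto
      then show "\<phi> (w \<bullet> x) * F w = 0" using zero by auto
    qed
  qed
  moreover have "x \<noteq> - x"
  proof
    assume "x = - x"
    then have "x \<bullet> x = - (x \<bullet> x)" by (metis inner_minus_left)
    then show False using X_inner_self[OF x] by simp
  qed
  ultimately show ?thesis by (simp add: X_inner_self[OF x])
qed

text \<open>
  Within the block \<open>i\<close> the indicators are the constants \<open>[i = p]\<close>, \<open>[i = q]\<close>, \<open>[i = r]\<close>,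
  where \<open>p, q, r\<close> are the blocks of \<open>x, y, z\<close>. The moment formula applies to each block; in the
  sum over \<open>i\<close> only the equalities between \<open>p, q, r\<close> matter, and they can be read off from
  the inner products of \<open>x, y, z\<close>.
\<close>

lemma gram_determined_block_affine:
  "gram_determined X (\<lambda>x y z. \<Sum>w\<in>X. block_affine a a' a'' (w \<bullet> x)
     * block_affine b b' b'' (w \<bullet> y) * block_affine c c' c'' (w \<bullet> z))"
proof -
  define B :: "real \<Rightarrow> real" where "B t = of_bool (t \<in> {0, 1, - 1})" for t
  show ?thesis
  proof (rule gram_determinedI)
    fix x y z assume "x \<in> X" "y \<in> X" "z \<in> X"
    then obtain p q r where p: "p \<in> {1..f}" "x \<in> block p" and q: "q \<in> {1..f}" "y \<in> block q"
      and r: "r \<in> {1..f}" "z \<in> block r" by (auto simp: X_eq)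
    have B: "B (x \<bullet> y) = of_bool (p = q)" "B (y \<bullet> z) = of_bool (q = r)" "B (z \<bullet> x) = of_bool (r = p)"
      using inner_block_iff p q r by (simp_all only: B_def)
    let ?a = "\<lambda>i. a + a' * of_bool (i = p)" and ?b = "\<lambda>i. b + b' * of_bool (i = q)"
      and ?c = "\<lambda>i. c + c' * of_bool (i = r)"
    have "(\<Sum>w\<in>block i. block_affine a a' a'' (w \<bullet> x) * block_affine b b' b'' (w \<bullet> y)
          * block_affine c c' c'' (w \<bullet> z))
        = 2 * (CARD('n) * (?a i * ?b i * ?c i) + ?a i * (b'' * c'' * (y \<bullet> z))
            + ?b i * (a'' * c'' * (x \<bullet> z)) + ?c i * (a'' * b'' * (x \<bullet> y)))"
      if i: "i \<in> {1..f}" for i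
    proof -
      have "(\<Sum>w\<in>block i. block_affine a a' a'' (w \<bullet> x) * block_affine b b' b'' (w \<bullet> y)
          * block_affine c c' c'' (w \<bullet> z))
        = (\<Sum>w\<in>block i. (?a i + a'' * (w \<bullet> x)) * (?b i + b'' * (w \<bullet> y)) * (?c i + c'' * (w \<bullet> z)))"
        using inner_block_iff[OF i p(1) _ p(2)] inner_block_iff[OF i q(1) _ q(2)]
          inner_block_iff[OF i r(1) _ r(2)]
        by (intro sum.cong refl) (simp only: block_affine_def)
      also have "\<dots> = 2 * (CARD('n) * (?a i * ?b i * ?c i) + ?a i * (b'' * c'' * (y \<bullet> z))
            + ?b i * (a'' * c'' * (x \<bullet> z)) + ?c i * (a'' * b'' * (x \<bullet> y)))"
        using sum_antipodal_affine3[OF basis[OF i], of "?a i" a'' x "?b i" b'' y "?c i" c'' z]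
        by simp
      finally show ?thesis .
    qed
    then have "(\<Sum>w\<in>X. block_affine a a' a'' (w \<bullet> x) * block_affine b b' b'' (w \<bullet> y)
          * block_affine c c' c'' (w \<bullet> z))
        = (\<Sum>i\<in>{1..f}. 2 * (CARD('n) * (?a i * ?b i * ?c i) + ?a i * (b'' * c'' * (y \<bullet> z))
            + ?b i * (a'' * c'' * (x \<bullet> z)) + ?c i * (a'' * b'' * (x \<bullet> y))))"
      unfolding sum_X by (rule sum.cong[OF refl])
    also have "\<dots> = 2 * (CARD('n) * (\<Sum>i\<in>{1..f}. ?a i * ?b i * ?c i)
          + (\<Sum>i\<in>{1..f}. ?a i) * (b'' * c'' * (y \<bullet> z))
          + (\<Sum>i\<in>{1..f}. ?b i) * (a'' * c'' * (x \<bullet> z))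
          + (\<Sum>i\<in>{1..f}. ?c i) * (a'' * b'' * (x \<bullet> y)))"
      unfolding sum_distrib_left[symmetric] sum_distrib_right[symmetric] sum.distrib ..
    also have "(\<Sum>i\<in>{1..f}. ?a i) = f * a + a'"
      using sum_point_masses[of "{1..f}" p p p a a' 1 0 1 0] p by simp
    also have "(\<Sum>i\<in>{1..f}. ?b i) = f * b + b'"
      using sum_point_masses[of "{1..f}" q q q b b' 1 0 1 0] q by simp
    also have "(\<Sum>i\<in>{1..f}. ?c i) = f * c + c'"
      using sum_point_masses[of "{1..f}" r r r c c' 1 0 1 0] r by simp
    also have "(\<Sum>i\<in>{1..f}. ?a i * ?b i * ?c i)
        = f * (a * b * c) + a' * b * c + a * b' * c + a * b * c' + a' * b' * c * B (x \<bullet> y)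
          + a * b' * c' * B (y \<bullet> z) + a' * b * c' * B (z \<bullet> x)
          + a' * b' * c' * (B (x \<bullet> y) * B (y \<bullet> z))"
      using sum_point_masses[of "{1..f}" p q r a a' b b' c c'] p q r by (simp add: B)
    finally show "(\<Sum>w\<in>X. block_affine a a' a'' (w \<bullet> x) * block_affine b b' b'' (w \<bullet> y)
          * block_affine c c' c'' (w \<bullet> z))
        = (\<lambda>u v t. 2 * (CARD('n) * (f * (a * b * c) + a' * b * c + a * b' * c + a * b * c'
          + a' * b' * c * B u + a * b' * c' * B v + a' * b * c' * B t + a' * b' * c' * (B u * B v))
          + (f * a + a') * (b'' * c'' * v) + (f * b + b') * (a'' * c'' * t)
          + (f * c + c') * (a'' * b'' * u))) (x \<bullet> y) (y \<bullet> z) (z \<bullet> x)"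
      by (simp only: inner_commute[of x z])
  qed
qed

text \<open>
  The three parameters of a block-affine function are just enough to prescribe its values at
  \<open>s\<close>, \<open>0\<close> and \<open>- s\<close>: the even and odd parts of \<open>\<phi>\<close> at \<open>s\<close> give \<open>k\<close> and \<open>l\<close>, and \<open>g\<close> then
  corrects the value at \<open>0\<close>.
\<close>

lemma block_affine_interpolation:
  obtains A where "\<And>t. t \<in> {s, 0, - s} \<Longrightarrow> \<phi> t = A t" and "\<exists>k g l. A = block_affine k g l"
proof -
  define k where "k = (\<phi> s + \<phi> (- s)) / 2"
  define l where "l = (\<phi> s - \<phi> (- s)) / (2 * s)"
  define A where "A = block_affine k (\<phi> 0 - k) l"
  have ls: "l * s = (\<phi> s - \<phi> (- s)) / 2" using s_bounds by (simp add: l_def)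
  have "\<phi> 0 = A 0" by (simp add: A_def block_affine_def)
  moreover have "A s = k + l * s" "A (- s) = k - l * s"
    using s_bounds by (simp_all add: A_def block_affine_def)
  then have "\<phi> s = A s" "\<phi> (- s) = A (- s)"
    unfolding ls by (simp_all add: k_def field_simps)
  ultimately show ?thesis using that[of A] A_def by blast
qed

text \<open>
  Each factor is replaced in turn by its block-affine interpolant; the three error sums are
  concentrated at \<open>\<plusminus>x\<close>, \<open>\<plusminus>y\<close> and \<open>\<plusminus>z\<close> respectively.
\<close>

lemma gram_determined_triple_sum:
  "gram_determined X (\<lambda>x y z. \<Sum>w\<in>X. \<phi> (w \<bullet> x) * \<psi> (w \<bullet> y) * \<rho> (w \<bullet> z))"
proof -
  obtain A where A: "\<And>t. t \<in> {s, 0, - s} \<Longrightarrow> \<phi> t = A t" "\<exists>k g l. A = block_affine k g l"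
    using block_affine_interpolation[of \<phi>] by blast
  obtain B where B: "\<And>t. t \<in> {s, 0, - s} \<Longrightarrow> \<psi> t = B t" "\<exists>k g l. B = block_affine k g l"
    using block_affine_interpolation[of \<psi>] by blast
  obtain C where C: "\<And>t. t \<in> {s, 0, - s} \<Longrightarrow> \<rho> t = C t" "\<exists>k g l. C = block_affine k g l"
    using block_affine_interpolation[of \<rho>] by blast
  have 1: "gram_determined X (\<lambda>x y z. \<Sum>w\<in>X. (\<phi> (w \<bullet> x) - A (w \<bullet> x)) * (\<psi> (w \<bullet> y) * \<rho> (w \<bullet> z)))"
    by (rule gram_determinedI[where H = "\<lambda>u v t. (\<phi> 1 - A 1) * (\<psi> u * \<rho> t)
          + (\<phi> (- 1) - A (- 1)) * (\<psi> (- u) * \<rho> (- t))"],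
        subst sum_supported_at_antipodes[where \<phi> = "\<lambda>t. \<phi> t - A t"])
      (simp_all add: A(1) inner_commute)
  have 2: "gram_determined X (\<lambda>x y z. \<Sum>w\<in>X. (\<psi> (w \<bullet> y) - B (w \<bullet> y)) * (A (w \<bullet> x) * \<rho> (w \<bullet> z)))"
    by (rule gram_determinedI[where H = "\<lambda>u v t. (\<psi> 1 - B 1) * (A u * \<rho> v)
          + (\<psi> (- 1) - B (- 1)) * (A (- u) * \<rho> (- v))"],
        subst sum_supported_at_antipodes[where \<phi> = "\<lambda>t. \<psi> t - B t"])
      (simp_all add: B(1) inner_commute)
  have 3: "gram_determined X (\<lambda>x y z. \<Sum>w\<in>X. (\<rho> (w \<bullet> z) - C (w \<bullet> z)) * (A (w \<bullet> x) * B (w \<bullet> y)))"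
    by (rule gram_determinedI[where H = "\<lambda>u v t. (\<rho> 1 - C 1) * (A t * B v)
          + (\<rho> (- 1) - C (- 1)) * (A (- t) * B (- v))"],
        subst sum_supported_at_antipodes[where \<phi> = "\<lambda>t. \<rho> t - C t"])
      (simp_all add: C(1) inner_commute)
  have 4: "gram_determined X (\<lambda>x y z. \<Sum>w\<in>X. A (w \<bullet> x) * B (w \<bullet> y) * C (w \<bullet> z))"
    using A(2) B(2) C(2) gram_determined_block_affine by blast
  have "\<phi> (w \<bullet> x) * \<psi> (w \<bullet> y) * \<rho> (w \<bullet> z)
      = (\<phi> (w \<bullet> x) - A (w \<bullet> x)) * (\<psi> (w \<bullet> y) * \<rho> (w \<bullet> z))
      + ((\<psi> (w \<bullet> y) - B (w \<bullet> y)) * (A (w \<bullet> x) * \<rho> (w \<bullet> z))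
      + ((\<rho> (w \<bullet> z) - C (w \<bullet> z)) * (A (w \<bullet> x) * B (w \<bullet> y))
      + A (w \<bullet> x) * B (w \<bullet> y) * C (w \<bullet> z)))" for w x y z :: "real ^ 'n"
    by (simp add: algebra_simps)
  then show ?thesis
    using gram_determined_add[OF 1 gram_determined_add[OF 2 gram_determined_add[OF 3 4]]]
    by (simp only: sum.distrib)
qed

section \<open>The association scheme\<close>

abbreviation "\<alpha> k \<equiv> [1, s, 0, - s, - 1] ! k"

abbreviation "R \<equiv> MUB_rel f M"

lemma R_iff: "(x, y) \<in> R k \<longleftrightarrow> x \<in> X \<and> y \<in> X \<and> x \<bullet> y = \<alpha> k"
  by (simp add: MUB_rel_def MUB_alpha_def s_def)

lemma alpha_simps:
  "\<alpha> 0 = 1" "\<alpha> (Suc 0) = s" "\<alpha> 2 = 0" "\<alpha> 3 = - s" "\<alpha> 4 = - 1"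
  by simp_all

lemma index_set: "{0..4::nat} = {0, Suc 0, 2, 3, 4}"
  by auto

lemma alpha_inj: "inj_on \<alpha> {0..4}"
  using s_bounds unfolding index_set by (auto simp: inj_on_def alpha_simps)

lemma triple_intersection_number:
  "\<exists>p. \<forall>x\<in>X. \<forall>y\<in>X. \<forall>z\<in>X. (x, y) \<in> R i \<and> (y, z) \<in> R j \<and> (z, x) \<in> R k \<longrightarrow>
     card {w \<in> X. (w, x) \<in> R m \<and> (w, y) \<in> R n \<and> (w, z) \<in> R l} = p"
proof -
  let ?ind = "\<lambda>m t. of_bool (t = \<alpha> m) :: real"
  obtain H where H: "\<And>x y z. x \<in> X \<Longrightarrow> y \<in> X \<Longrightarrow> z \<in> X \<Longrightarrow>
      (\<Sum>w\<in>X. ?ind m (w \<bullet> x) * ?ind n (w \<bullet> y) * ?ind l (w \<bullet> z)) = H (x \<bullet> y) (y \<bullet> z) (z \<bullet> x)"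
    using gram_determined_triple_sum[of "?ind m" "?ind n" "?ind l"]
    unfolding gram_determined_def by blast
  \<comment> \<open>The floor only names a witness in \<open>nat\<close>: \<open>H\<close> takes the cardinality as its value if a
    triple realises the Gram matrix, and an arbitrary real one otherwise.\<close>
  have "card {w \<in> X. (w, x) \<in> R m \<and> (w, y) \<in> R n \<and> (w, z) \<in> R l} = nat \<lfloor>H (\<alpha> i) (\<alpha> j) (\<alpha> k)\<rfloor>"
    (is "card ?W = _")
    if xyz: "x \<in> X" "y \<in> X" "z \<in> X" "(x, y) \<in> R i \<and> (y, z) \<in> R j \<and> (z, x) \<in> R k" for x y z
  proof -
    have "?W = X \<inter> {w. w \<bullet> x = \<alpha> m \<and> w \<bullet> y = \<alpha> n \<and> w \<bullet> z = \<alpha> l}"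
      using xyz(1-3) by (auto simp only: R_iff)
    then have "real (card ?W) = (\<Sum>w\<in>X. of_bool (w \<bullet> x = \<alpha> m \<and> w \<bullet> y = \<alpha> n \<and> w \<bullet> z = \<alpha> l))"
      using finite_X by (simp only: sum_of_bool_eq)
    also have "\<dots> = H (x \<bullet> y) (y \<bullet> z) (z \<bullet> x)"
      using H[OF xyz(1-3)] by (simp only: of_bool_conj mult.assoc)
    also have "\<dots> = H (\<alpha> i) (\<alpha> j) (\<alpha> k)"
      using xyz(4) by (simp only: R_iff)
    finally have "nat \<lfloor>real (card ?W)\<rfloor> = nat \<lfloor>H (\<alpha> i) (\<alpha> j) (\<alpha> k)\<rfloor>"
      by (rule arg_cong)
    then show ?thesis by (simp only: floor_of_nat nat_int)
  qed
  then show ?thesis by (intro exI ballI impI)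
qed

lemma intersection_number:
  "\<exists>p. \<forall>x y. (x, y) \<in> R k \<longrightarrow> card {w \<in> X. (x, w) \<in> R i \<and> (w, y) \<in> R j} = p"
proof -
  obtain p where p: "\<And>x y z. \<lbrakk>x \<in> X; y \<in> X; z \<in> X; (x, y) \<in> R k; (y, z) \<in> R 0; (z, x) \<in> R k\<rbrakk>
      \<Longrightarrow> card {w \<in> X. (w, x) \<in> R i \<and> (w, y) \<in> R j \<and> (w, z) \<in> R j} = p"
    using triple_intersection_number[of k 0 k i j j] by blast
  have "card {w \<in> X. (x, w) \<in> R i \<and> (w, y) \<in> R j} = p" if "(x, y) \<in> R k" for x y
    using p[of x y y] that
    by (simp add: R_iff inner_commute[of x] X_inner_self alpha_simps cong: conj_cong)
  then show ?thesis by blast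
qed

text \<open>
  Two blocks are needed here: the relations for \<open>s\<close> and \<open>- s\<close> are realised by points of
  different bases, one from the other by a change of sign.
\<close>

lemma R_nonempty:
  assumes "f \<ge> 2" "k \<in> {0..4}"
  shows "R k \<noteq> {}"
proof -
  have i: "1 \<in> {1..f}" "2 \<in> {1..f}" using assms(1) by auto
  have card: "card (M 1) \<ge> 2" "card (M 2) \<ge> 2"
    using orthonormal_basis_card[OF basis] i dim_ge_2 by simp_all
  then obtain x y where xy: "x \<in> M 1" "y \<in> M 1" "x \<noteq> y"
    by (auto simp: numeral_2_eq_2 card_le_Suc_iff)
  obtain z where z: "z \<in> M 2" using card by fastforce
  have blk: "x \<in> block 1" "z \<in> block 2" using xy z by (auto simp: antipodal_def)
  then have X: "x \<in> X" "y \<in> X" "z \<in> X" "- x \<in> X" "- z \<in> X"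
    using xy z i by (auto simp: MUB_points_def)
  have "x \<bullet> z = s \<or> x \<bullet> z = - s" using inner_different_blocks[OF i _ blk] by auto
  then have "(\<exists>v\<in>X. x \<bullet> v = s) \<and> (\<exists>v\<in>X. x \<bullet> v = - s)"
    using X by (metis add.inverse_inverse inner_minus_right)
  moreover have "x \<bullet> y = 0" using orthonormal_basis_inner[OF basis[OF i(1)] xy(1,2)] xy(3) by simp
  moreover have "x \<bullet> x = 1" "\<exists>v\<in>X. x \<bullet> v = - 1"
    using X X_inner_self by (auto intro: bexI[of _ "- x"])
  ultimately have "\<exists>v\<in>X. x \<bullet> v = \<alpha> k"
    using assms(2) X unfolding index_set by (auto simp: alpha_simps)
  then show ?thesis using X R_iff by blast
qed

lemma symmetric_association_scheme_MUB:
  assumes "f \<ge> 2"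
  shows "symmetric_association_scheme X 4 R"
proof -
  have disj: "R k \<inter> R l = {}" if "k \<in> {0..4}" "l \<in> {0..4}" "k \<noteq> l" for k l
    using inj_onD[OF alpha_inj] that by (auto simp: R_iff)
  have inj: "inj_on R {0..4}"
  proof (rule inj_onI, rule ccontr)
    fix k l assume *: "k \<in> {0..4::nat}" "l \<in> {0..4::nat}" "R k = R l" "k \<noteq> l"
    then show False using disj[of k l] R_nonempty[OF assms, of l] by simp
  qed
  have "partition_on (X \<times> X) (R ` {0..4})"
  proof (rule partition_onI)
    show "\<Union> (R ` {0..4}) = X \<times> X"
    proof (intro equalityI subrelI)
      fix x y assume "(x, y) \<in> X \<times> X"
      then have "\<exists>k\<in>{0..4}. x \<bullet> y = \<alpha> k"
        using inner_cases[of x y] unfolding index_set by (auto simp: alpha_simps)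
      then show "(x, y) \<in> \<Union> (R ` {0..4})"
        using \<open>(x, y) \<in> X \<times> X\<close> by (auto simp: R_iff)
    qed (auto simp: R_iff)
    show "disjnt p q" if pq: "p \<in> R ` {0..4}" "q \<in> R ` {0..4}" "p \<noteq> q" for p q
    proof -
      obtain k l where "k \<in> {0..4}" "l \<in> {0..4}" "p = R k" "q = R l"
        using pq(1,2) by blast
      then show ?thesis using pq(3) disj[of k l] by (auto simp only: disjnt_def)
    qed
    show "{} \<notin> R ` {0..4}"
      using R_nonempty[OF assms] by blast
  qed
  moreover have "sym (R k)" for k by (auto simp: sym_def R_iff inner_commute)
  moreover have "R 0 = Id_on X"
    by (auto simp: R_iff alpha_simps inner_eq_1_iff)
  ultimately show ?thesis
    using finite_X inj intersection_number by (simp add: symmetric_association_scheme_def)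
qed

end

theorem corollary5p2:
  fixes M :: "nat \<Rightarrow> (real ^ 'n) set" and f :: nat
  assumes "CARD('n) \<ge> 2" and "f \<ge> 2" and "real_MUB f M"
  shows "triply_regular_scheme (MUB_points f M) 4 (MUB_rel f M)"
proof -
  interpret real_mub_system M f "1 / sqrt CARD('n)"
    using assms by unfold_locales simp_all
  show ?thesis
    unfolding triply_regular_scheme_def
    using symmetric_association_scheme_MUB[OF assms(2)] triple_intersection_number by blast
qed

end
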